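(* Let $F(z)=z-H(z)$ be a formal map from $\mathbb{C}^n$ to $\mathbb{C}^n$ with $o(H(z))\ge 2$. Then the formal inverse map of $F$ is $G(z)=z+H(z)$ if and only if $JH\cdot H=0$.
   Context: $z=(z_1,\dots,z_n)$; $H(z)\in\mathbb{C}[[z]]^{\times n}$ is a column vector of $n$ formal power series. $o(H(z))\ge 2$ means every monomial occurring in any component of $H$ has total degree at least $2$. $JH=(\partial H_i/\partial z_j)_{i,j}$ is the Jacobian matrix and $JH\cdot H$ is the matrix-vector product. The formal inverse $G$ of $F$ is the formal map with $F(G(z))=G(F(z))=z$. *)

theory Defs
  imports "HOL-Analysis.Analysis"
begin

text \<open>
  Formal power series in the variables \<open>z_i\<close>, \<open>i\<close> ranging over a finite type \<open>'n\<close>.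
  The monomial \<open>\<Prod>i. z_i ^ (\<alpha> $ i)\<close> is represented by its exponent vector \<open>\<alpha> :: nat ^ 'n\<close>.
\<close>

typedef (overloaded) ('a, 'n::finite) mfps = "UNIV :: (nat ^ 'n \<Rightarrow> 'a) set"
  morphisms mcoeff Abs_mfps
  by simp

lemma mcoeff_Abs_mfps [simp]: "mcoeff (Abs_mfps f) = f"
  by (simp add: Abs_mfps_inverse)

lemma mfps_eqI: "(\<And>\<alpha>. mcoeff f \<alpha> = mcoeff g \<alpha>) \<Longrightarrow> f = g"
  by (metis ext mcoeff_inject)

definition antidiag :: "nat ^ 'n \<Rightarrow> ((nat ^ 'n) \<times> (nat ^ 'n)) set" where
  "antidiag \<alpha> = {(\<beta>, \<gamma>). \<beta> + \<gamma> = \<alpha>}"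

lemma in_antidiag [simp]: "(\<beta>, \<gamma>) \<in> antidiag \<alpha> \<longleftrightarrow> \<beta> + \<gamma> = \<alpha>"
  by (simp add: antidiag_def)

lemma finite_nat_vec_le: "finite {\<beta> :: nat ^ 'n. \<forall>i. \<beta> $ i \<le> \<alpha> $ i}"
proof (rule finite_imageD)
  show "finite (vec_nth ` {\<beta> :: nat ^ 'n. \<forall>i. \<beta> $ i \<le> \<alpha> $ i})"
    by (rule finite_subset [of _ "Pi\<^sub>E UNIV (\<lambda>i. {..\<alpha> $ i})"]) (auto intro: finite_PiE)
  show "inj_on vec_nth {\<beta> :: nat ^ 'n. \<forall>i. \<beta> $ i \<le> \<alpha> $ i}"
    by (auto simp: inj_on_def vec_eq_iff)
qed

lemma finite_antidiag [simp]: "finite (antidiag \<alpha>)"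
proof (rule finite_subset)
  let ?B = "{\<beta>. \<forall>i. \<beta> $ i \<le> \<alpha> $ i}"
  show "antidiag \<alpha> \<subseteq> ?B \<times> ?B"
    by (auto simp: antidiag_def)
  show "finite (?B \<times> ?B)"
    by (intro finite_cartesian_product finite_nat_vec_le)
qed

lemma antidiag_0 [simp]: "antidiag 0 = {(0, 0)}"
  by (auto simp: antidiag_def vec_eq_iff)

instantiation mfps :: (comm_ring_1, finite) comm_ring_1
begin

definition zero_mfps_def: "0 = Abs_mfps (\<lambda>_. 0)"

definition one_mfps_def: "1 = Abs_mfps (\<lambda>\<alpha>. if \<alpha> = 0 then 1 else 0)"

definition plus_mfps_def: "f + g = Abs_mfps (\<lambda>\<alpha>. mcoeff f \<alpha> + mcoeff g \<alpha>)"

definition uminus_mfps_def: "- f = Abs_mfps (\<lambda>\<alpha>. - mcoeff f \<alpha>)"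

definition minus_mfps_def: "f - g = Abs_mfps (\<lambda>\<alpha>. mcoeff f \<alpha> - mcoeff g \<alpha>)"

definition times_mfps_def:
  "f * g = Abs_mfps (\<lambda>\<alpha>. \<Sum>(\<beta>, \<gamma>) \<in> antidiag \<alpha>. mcoeff f \<beta> * mcoeff g \<gamma>)"

instance
proof
  fix f g h :: "('a, 'b) mfps"
  show "f * g * h = f * (g * h)"
  proof (rule mfps_eqI)
    fix \<alpha>
    let ?t = "\<lambda>a b c. mcoeff f a * mcoeff g b * mcoeff h c"
    have "mcoeff (f * g * h) \<alpha> =
        (\<Sum>x\<in>antidiag \<alpha>. \<Sum>y\<in>antidiag (fst x). ?t (fst y) (snd y) (snd x))"
      by (simp add: times_mfps_def sum_distrib_right case_prod_beta)
    also have "\<dots> = (\<Sum>(x, y)\<in>(SIGMA x:antidiag \<alpha>. antidiag (fst x)). ?t (fst y) (snd y) (snd x))"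
      by (rule sum.Sigma) auto
    also have "\<dots> = (\<Sum>(x, y)\<in>(SIGMA x:antidiag \<alpha>. antidiag (snd x)). ?t (fst x) (fst y) (snd y))"
      by (rule sum.reindex_bij_witness
          [of _ "\<lambda>((a, p), (b, c)). ((a + b, c), (a, b))" "\<lambda>((p, c), (a, b)). ((a, b + c), (b, c))"])
        (auto simp: add.assoc)
    also have "\<dots> = (\<Sum>x\<in>antidiag \<alpha>. \<Sum>y\<in>antidiag (snd x). ?t (fst x) (fst y) (snd y))"
      by (rule sum.Sigma [symmetric]) auto
    also have "\<dots> = mcoeff (f * (g * h)) \<alpha>"
      by (simp add: times_mfps_def sum_distrib_left case_prod_beta mult.assoc)
    finally show "mcoeff (f * g * h) \<alpha> = mcoeff (f * (g * h)) \<alpha>" .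
  qed
  show "f * g = g * f"
  proof (rule mfps_eqI)
    fix \<alpha>
    show "mcoeff (f * g) \<alpha> = mcoeff (g * f) \<alpha>"
      unfolding times_mfps_def mcoeff_Abs_mfps
      by (rule sum.reindex_bij_witness [of _ prod.swap prod.swap])
        (auto simp: add.commute mult.commute)
  qed
  show "1 * f = f"
  proof (rule mfps_eqI)
    fix \<alpha>
    have "mcoeff (1 * f) \<alpha> =
        (\<Sum>x\<in>antidiag \<alpha>. if x = (0, \<alpha>) then mcoeff f \<alpha> else 0)"
      unfolding times_mfps_def one_mfps_def mcoeff_Abs_mfps
      by (rule sum.cong) (auto split: if_splits)
    then show "mcoeff (1 * f) \<alpha> = mcoeff f \<alpha>"
      by simp
  qed
  show "(f + g) * h = f * h + g * h"
    by (simp add: times_mfps_def plus_mfps_def case_prod_beta distrib_right sum.distrib)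
  have "mcoeff (0 :: ('a, 'b) mfps) 0 \<noteq> mcoeff 1 0"
    by (simp add: zero_mfps_def one_mfps_def)
  then show "(0 :: ('a, 'b) mfps) \<noteq> 1"
    by metis
qed (auto simp: zero_mfps_def plus_mfps_def minus_mfps_def uminus_mfps_def algebra_simps
    intro!: mfps_eqI)

end

definition mdegree :: "nat ^ 'n \<Rightarrow> nat" where
  "mdegree \<alpha> = (\<Sum>i\<in>UNIV. \<alpha> $ i)"

definition mvar :: "'n \<Rightarrow> ('a::comm_ring_1, 'n::finite) mfps" where
  "mvar i = Abs_mfps (\<lambda>\<alpha>. if \<alpha> = axis i 1 then 1 else 0)"

text \<open>
  A formal map from \<open>'a ^ 'n\<close> to itself is a column vector of series; \<open>mvars\<close> is the identity map.
\<close>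

definition mvars :: "('a::comm_ring_1, 'n::finite) mfps ^ 'n" where
  "mvars = (\<chi> i. mvar i)"

text \<open>\<open>map_order_ge H d\<close> is the condition \<open>o(H) \<ge> d\<close> (which also holds for \<open>H = 0\<close>).\<close>

definition map_order_ge :: "('a::comm_ring_1, 'n::finite) mfps ^ 'n \<Rightarrow> nat \<Rightarrow> bool" where
  "map_order_ge H d \<longleftrightarrow> (\<forall>i \<alpha>. mcoeff (H $ i) \<alpha> \<noteq> 0 \<longrightarrow> d \<le> mdegree \<alpha>)"

definition mderiv :: "'n \<Rightarrow> ('a::comm_ring_1, 'n::finite) mfps \<Rightarrow> ('a, 'n) mfps" where
  "mderiv j f = Abs_mfps (\<lambda>\<alpha>. of_nat (\<alpha> $ j + 1) * mcoeff f (\<alpha> + axis j 1))"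

definition jacobian_mfps :: "('a::comm_ring_1, 'n::finite) mfps ^ 'n \<Rightarrow> ('a, 'n) mfps ^ 'n ^ 'n" where
  "jacobian_mfps H = (\<chi> i j. mderiv j (H $ i))"

text \<open>
  Substitution \<open>f(G(z)) = \<Sum>\<beta>. f_\<beta> * G(z)^\<beta>\<close>. It is meaningful only when every component of \<open>G\<close> has
  zero constant term; then \<open>G(z)^\<beta>\<close> has order at least \<open>|\<beta>|\<close>, so only the finitely many \<open>\<beta>\<close> with
  \<open>|\<beta>| \<le> |\<alpha>|\<close> contribute to the coefficient at \<open>\<alpha>\<close>.
\<close>

definition msubst ::
    "('a::comm_ring_1, 'n::finite) mfps \<Rightarrow> ('a, 'n) mfps ^ 'n \<Rightarrow> ('a, 'n) mfps" where
  "msubst f G = Abs_mfps (\<lambda>\<alpha>. \<Sum>\<beta> | mdegree \<beta> \<le> mdegree \<alpha>.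
     mcoeff f \<beta> * mcoeff (\<Prod>i\<in>UNIV. (G $ i) ^ (\<beta> $ i)) \<alpha>)"

definition map_compose ::
    "('a::comm_ring_1, 'n::finite) mfps ^ 'n \<Rightarrow> ('a, 'n) mfps ^ 'n \<Rightarrow> ('a, 'n) mfps ^ 'n" where
  "map_compose F G = (\<chi> i. msubst (F $ i) G)"

text \<open>
  The requirement that \<open>F\<close> and \<open>G\<close> have no constant terms makes both compositions meaningful.
\<close>

definition is_formal_inverse ::
    "('a::comm_ring_1, 'n::finite) mfps ^ 'n \<Rightarrow> ('a, 'n) mfps ^ 'n \<Rightarrow> bool" where
  "is_formal_inverse F G \<longleftrightarrow> map_order_ge F 1 \<and> map_order_ge G 1 \<and>
     map_compose F G = mvars \<and> map_compose G F = mvars"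

end

theory Submission
  imports Defs
begin

text \<open>
  Substituting \<open>z + H\<close> into \<open>z - H\<close>, and conversely, shows that the two maps are inverse to each
  other exactly when \<open>H(z + H) = H\<close> and \<open>H(z - H) = H\<close>.  Both equations are read off from the curve
  \<open>t \<mapsto> H(z + t H)\<close>, whose velocity at \<open>t = 0\<close> is \<open>JH \<cdot> H\<close>.

  Let \<open>D = \<Sum>j. H_j \<partial>_j\<close>, so that \<open>D z_i = H_i\<close> and \<open>(JH \<cdot> H)_i = D H_i\<close>.  If \<open>D H = 0\<close>, the lines
  \<open>z + t H\<close> are the flow of \<open>D\<close>, and \<open>H\<close> is constant along a flow that annihilates it.  The converse
  needs a version of this that tolerates an error.  The operator \<open>d/dt - D\<close> is a derivation on curves
  of power series; its value on a curve is called the flow defect of the curve.  The defect of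
  \<open>z + t H\<close> is \<open>- t D H\<close>.  If \<open>D H\<close> has order at least \<open>e + 1\<close>, then by the product rule the defect
  of \<open>(z + t H)^\<beta>\<close> has order at least \<open>e + |\<beta>|\<close>.  Only \<open>|\<beta>| \<ge> 2\<close> occurs in \<open>H\<close>, so the defect of
  \<open>H(z + t H)\<close> has order at least \<open>e + 2\<close>; the same is true of the explicit curve \<open>H + t D H\<close>, which
  has the same starting point.  As \<open>D\<close> raises orders, the equation \<open>dw/dt = D w\<close> has a unique solution
  up to any given order (\<open>order_ge_of_small_flow_defect\<close>), and therefore
  \<open>H(z + t H) = H + t D H\<close> in all degrees up to \<open>e + 1\<close> (\<open>mcoeff_msubst_translate\<close>).

  If \<open>D H = 0\<close>, this holds for every \<open>e\<close>, and \<open>t = 1\<close> and \<open>t = -1\<close> give the two equations.  If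
  \<open>H(z + H) = H\<close>, then \<open>t = 1\<close> shows that \<open>D H\<close> vanishes in degree \<open>e + 1\<close> as well, so \<open>D H = 0\<close> by
  induction on \<open>e\<close>.
\<close>

section \<open>Coefficients, constants and order\<close>

lemma mcoeff_zero [simp]: "mcoeff 0 \<alpha> = 0"
  by (simp add: zero_mfps_def)

lemma mcoeff_one: "mcoeff 1 \<alpha> = (if \<alpha> = 0 then 1 else 0)"
  by (simp add: one_mfps_def)

lemma mcoeff_add [simp]: "mcoeff (f + g) \<alpha> = mcoeff f \<alpha> + mcoeff g \<alpha>"
  by (simp add: plus_mfps_def)

lemma mcoeff_uminus [simp]: "mcoeff (- f) \<alpha> = - mcoeff f \<alpha>"
  by (simp add: uminus_mfps_def)

lemma mcoeff_diff [simp]: "mcoeff (f - g) \<alpha> = mcoeff f \<alpha> - mcoeff g \<alpha>"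
  by (simp add: minus_mfps_def)

lemma mcoeff_mult: "mcoeff (f * g) \<alpha> = (\<Sum>(\<beta>, \<gamma>)\<in>antidiag \<alpha>. mcoeff f \<beta> * mcoeff g \<gamma>)"
  by (simp add: times_mfps_def)

lemma mcoeff_sum: "mcoeff (sum f S) \<alpha> = (\<Sum>x\<in>S. mcoeff (f x) \<alpha>)"
  by (induction S rule: infinite_finite_induct) auto

definition mmonom :: "nat ^ 'n \<Rightarrow> ('a::comm_ring_1, 'n::finite) mfps" where
  "mmonom \<beta> = Abs_mfps (\<lambda>\<alpha>. if \<alpha> = \<beta> then 1 else 0)"

definition mconst :: "'a::comm_ring_1 \<Rightarrow> ('a, 'n::finite) mfps" where
  "mconst c = Abs_mfps (\<lambda>\<alpha>. if \<alpha> = 0 then c else 0)"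

lemma mcoeff_mconst_mult [simp]: "mcoeff (mconst c * f) \<alpha> = c * mcoeff f \<alpha>"
proof -
  have "mcoeff (mconst c * f) \<alpha> = (\<Sum>x\<in>antidiag \<alpha>. if x = (0, \<alpha>) then c * mcoeff f \<alpha> else 0)"
    unfolding mcoeff_mult mconst_def mcoeff_Abs_mfps
    by (rule sum.cong) (auto split: if_splits)
  then show ?thesis by simp
qed

lemma mconst_0 [simp]: "mconst 0 = 0"
  and mconst_1 [simp]: "mconst 1 = 1"
  and mconst_minus_1 [simp]: "mconst (-1) = -1"
  by (rule mfps_eqI; simp add: mconst_def mcoeff_one)+

lemma mmonom_mult: "mmonom \<beta> * mmonom \<gamma> = mmonom (\<beta> + \<gamma>)"
proof (rule mfps_eqI)
  fix \<alpha>
  have "mcoeff (mmonom \<beta> * mmonom \<gamma> :: ('a, 'b) mfps) \<alpha> =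
      (\<Sum>x\<in>antidiag \<alpha>. if x = (\<beta>, \<gamma>) then 1 else 0)"
    unfolding mcoeff_mult mmonom_def mcoeff_Abs_mfps
    by (rule sum.cong) (auto split: if_splits)
  then show "mcoeff (mmonom \<beta> * mmonom \<gamma> :: ('a, 'b) mfps) \<alpha> = mcoeff (mmonom (\<beta> + \<gamma>)) \<alpha>"
    by (auto simp: mmonom_def)
qed

lemma mvar_eq_mmonom: "mvar i = mmonom (axis i 1)"
  by (simp add: mvar_def mmonom_def)

lemma mvar_power: "mvar i ^ k = mmonom (axis i k)"
proof (induction k)
  case 0
  have "axis i 0 = (0 :: nat ^ 'b)"
    by (simp add: vec_eq_iff axis_def)
  then show ?case
    by (intro mfps_eqI) (simp add: mmonom_def mcoeff_one)
next
  case (Suc k)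
  have "axis i 1 + axis i k = (axis i (Suc k) :: nat ^ 'b)"
    by (simp add: vec_eq_iff axis_def)
  then show ?case
    using Suc by (simp add: mvar_eq_mmonom mmonom_mult)
qed

lemma prod_mvar_power:
  "(\<Prod>i\<in>UNIV. mvar i ^ (\<beta> $ i)) = (mmonom \<beta> :: ('a::comm_ring_1, 'n::finite) mfps)"
proof -
  have "(\<Prod>i\<in>S. mvar i ^ (\<beta> $ i)) =
      (mmonom (\<Sum>i\<in>S. axis i (\<beta> $ i)) :: ('a, 'n) mfps)" if "finite S" for S
    using that
  proof induction
    case empty
    show ?case
      by (intro mfps_eqI) (simp add: mmonom_def mcoeff_one)
  qed (simp add: mvar_power mmonom_mult)
  moreover have "(\<Sum>i\<in>UNIV. axis i (\<beta> $ i)) = \<beta>"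
    by (simp add: vec_eq_iff axis_def)
  ultimately show ?thesis
    by (metis finite)
qed

lemma mdegree_add: "mdegree (\<alpha> + \<beta>) = mdegree \<alpha> + mdegree \<beta>"
  and mdegree_axis: "mdegree (axis i k) = k"
  by (simp_all add: mdegree_def sum.distrib axis_def)

lemma finite_mdegree_le: "finite {\<beta> :: nat ^ 'n::finite. mdegree \<beta> \<le> N}"
proof (rule finite_subset)
  show "{\<beta> :: nat ^ 'n. mdegree \<beta> \<le> N} \<subseteq> {\<beta>. \<forall>i. \<beta> $ i \<le> (\<chi> i. N) $ i}"
    unfolding mdegree_def
    by (auto intro: order_trans [OF member_le_sum [of _ UNIV "($) _"]])
qed (rule finite_nat_vec_le)

definition order_ge :: "('a::comm_ring_1, 'n::finite) mfps \<Rightarrow> nat \<Rightarrow> bool" where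
  "order_ge f d \<longleftrightarrow> (\<forall>\<alpha>. mdegree \<alpha> < d \<longrightarrow> mcoeff f \<alpha> = 0)"

lemma map_order_ge_iff: "map_order_ge H d \<longleftrightarrow> (\<forall>i. order_ge (H $ i) d)"
  unfolding map_order_ge_def order_ge_def by (metis linorder_not_less)

lemma order_geD: "order_ge f d \<Longrightarrow> mdegree \<alpha> < d \<Longrightarrow> mcoeff f \<alpha> = 0"
  by (simp add: order_ge_def)

lemma order_ge_mono: "order_ge f d \<Longrightarrow> d' \<le> d \<Longrightarrow> order_ge f d'"
  by (simp add: order_ge_def)

lemma order_ge_0 [simp]: "order_ge f 0"
  by (simp add: order_ge_def)

lemma order_ge_zero [simp]: "order_ge 0 d"
  by (simp add: order_ge_def)

lemma order_ge_add: "order_ge f d \<Longrightarrow> order_ge g d \<Longrightarrow> order_ge (f + g) d"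
  and order_ge_uminus: "order_ge f d \<Longrightarrow> order_ge (- f) d"
  and order_ge_mconst_mult: "order_ge f d \<Longrightarrow> order_ge (mconst c * f) d"
  by (simp_all add: order_ge_def)

lemma order_ge_sum: "(\<And>x. x \<in> S \<Longrightarrow> order_ge (f x) d) \<Longrightarrow> order_ge (sum f S) d"
  by (simp add: order_ge_def mcoeff_sum)

lemma order_ge_mult:
  assumes "order_ge f a" "order_ge g b"
  shows "order_ge (f * g) (a + b)"
  unfolding order_ge_def mcoeff_mult
proof (intro allI impI sum.neutral ballI)
  fix \<alpha> :: "nat ^ 'b" and x
  assume "mdegree \<alpha> < a + b" "x \<in> antidiag \<alpha>"
  then have "mdegree (fst x) < a \<or> mdegree (snd x) < b"
    by (cases x) (auto simp: mdegree_add)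
  then show "(case x of (\<beta>, \<gamma>) \<Rightarrow> mcoeff f \<beta> * mcoeff g \<gamma>) = 0"
    using assms by (auto simp: order_ge_def case_prod_beta)
qed

lemma order_ge_power: "order_ge f a \<Longrightarrow> order_ge (f ^ k) (k * a)"
  by (induction k) (simp_all add: order_ge_mult)

lemma order_ge_mvar: "order_ge (mvar i) 1"
  by (auto simp: order_ge_def mvar_def mdegree_axis)


section \<open>Partial derivatives\<close>

lemma mderiv_add: "mderiv j (f + g) = mderiv j f + mderiv j g"
  and mderiv_diff: "mderiv j (f - g) = mderiv j f - mderiv j g"
  and mderiv_mconst_mult: "mderiv j (mconst c * f) = mconst c * mderiv j f"
  by (rule mfps_eqI; simp add: mderiv_def ring_distribs mult.left_commute)+

lemma mderiv_mvar: "mderiv j (mvar i) = (if i = j then 1 else 0)"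
proof (rule mfps_eqI)
  fix \<alpha> :: "nat ^ 'b"
  have "\<alpha> + axis j 1 = axis i 1 \<longleftrightarrow> i = j \<and> \<alpha> = 0"
    by (auto simp: vec_eq_iff axis_def)
  then show "mcoeff (mderiv j (mvar i) :: ('a, 'b) mfps) \<alpha> = mcoeff (if i = j then 1 else 0) \<alpha>"
    by (auto simp: mderiv_def mvar_def mcoeff_one)
qed

text \<open>
  Indexing by the exponents of \<open>z_j f g\<close> instead of those of \<open>f g\<close> puts \<open>(\<partial>_j f) g\<close> and \<open>f (\<partial>_j g)\<close>
  over the same index set, where the Leibniz rule becomes \<open>\<beta>_j + \<gamma>_j = \<alpha>_j + 1\<close>.
\<close>

lemma mcoeff_mderiv_mult:
  "mcoeff (mderiv j f * g) \<alpha> =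
     (\<Sum>(\<beta>, \<gamma>)\<in>antidiag (\<alpha> + axis j 1). of_nat (\<beta> $ j) * mcoeff f \<beta> * mcoeff g \<gamma>)"
proof -
  let ?S = "antidiag (\<alpha> + axis j 1)"
  let ?t = "\<lambda>(\<beta>, \<gamma>). of_nat (\<beta> $ j) * mcoeff f \<beta> * mcoeff g \<gamma>"
  have diff_axis_add: "\<beta> - axis j 1 + axis j 1 = \<beta>" if "0 < \<beta> $ j" for \<beta> :: "nat ^ 'b"
    using that by (simp add: vec_eq_iff axis_def)
  have diff_axis_add': "\<beta> - axis j 1 + \<gamma> = \<alpha>" if "0 < \<beta> $ j" "\<beta> + \<gamma> = \<alpha> + axis j 1" for \<beta> \<gamma>
  proof -
    have "\<beta> - axis j 1 + \<gamma> + axis j 1 = \<alpha> + axis j 1"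
      using diff_axis_add [OF that(1)] that(2) by (simp add: add.assoc add.commute [of \<gamma>])
        (simp flip: add.assoc)
    then show ?thesis
      by (rule add_right_imp_eq)
  qed
  have component: "axis j (Suc 0) $ j = Suc 0"
    by (simp add: axis_def)
  have "sum ?t ?S = sum ?t {p \<in> ?S. fst p $ j \<noteq> 0}"
    by (rule sum.mono_neutral_right) (auto intro!: gr0I)
  also have "\<dots> = (\<Sum>(\<beta>, \<gamma>)\<in>antidiag \<alpha>. mcoeff (mderiv j f) \<beta> * mcoeff g \<gamma>)"
    by (rule sum.reindex_bij_witness
          [of _ "\<lambda>(\<beta>, \<gamma>). (\<beta> + axis j 1, \<gamma>)" "\<lambda>(\<beta>, \<gamma>). (\<beta> - axis j 1, \<gamma>)"])
      (auto simp: mderiv_def diff_axis_add [simplified] diff_axis_add' [simplified] component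
        add.assoc add.commute [of "axis j (Suc 0)"])
  finally show ?thesis
    by (simp add: mcoeff_mult)
qed

lemma mderiv_mult: "mderiv j (f * g) = mderiv j f * g + f * mderiv j g"
proof (rule mfps_eqI)
  fix \<alpha>
  let ?S = "antidiag (\<alpha> + axis j 1)"
  have "mcoeff (mderiv j (f * g)) \<alpha> =
      (\<Sum>(\<beta>, \<gamma>)\<in>?S. of_nat ((\<alpha> + axis j 1) $ j) * (mcoeff f \<beta> * mcoeff g \<gamma>))"
    by (simp add: mderiv_def mcoeff_mult sum_distrib_left case_prod_beta axis_def)
  also have "\<dots> = (\<Sum>(\<beta>, \<gamma>)\<in>?S. of_nat (\<beta> $ j) * mcoeff f \<beta> * mcoeff g \<gamma>
      + of_nat (\<gamma> $ j) * mcoeff g \<gamma> * mcoeff f \<beta>)"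
  proof (rule sum.cong, simp, clarify)
    fix \<beta> \<gamma> assume "(\<beta>, \<gamma>) \<in> ?S"
    then have "(\<alpha> + axis j 1) $ j = \<beta> $ j + \<gamma> $ j"
      by (metis in_antidiag vector_add_component)
    then show "of_nat ((\<alpha> + axis j 1) $ j) * (mcoeff f \<beta> * mcoeff g \<gamma>) =
        of_nat (\<beta> $ j) * mcoeff f \<beta> * mcoeff g \<gamma> + of_nat (\<gamma> $ j) * mcoeff g \<gamma> * mcoeff f \<beta>"
      by (simp only: of_nat_add) (simp add: algebra_simps)
  qed
  also have "\<dots> = mcoeff (mderiv j f * g) \<alpha>
      + (\<Sum>(\<beta>, \<gamma>)\<in>?S. of_nat (\<gamma> $ j) * mcoeff g \<gamma> * mcoeff f \<beta>)"
    unfolding mcoeff_mderiv_mult by (simp add: sum.distrib case_prod_beta)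
  also have "(\<Sum>(\<beta>, \<gamma>)\<in>?S. of_nat (\<gamma> $ j) * mcoeff g \<gamma> * mcoeff f \<beta>) = mcoeff (mderiv j g * f) \<alpha>"
    unfolding mcoeff_mderiv_mult
    by (rule sum.reindex_bij_witness [of _ prod.swap prod.swap]) (auto simp: add.commute)
  finally show "mcoeff (mderiv j (f * g)) \<alpha> = mcoeff (mderiv j f * g + f * mderiv j g) \<alpha>"
    by (simp add: mult.commute)
qed

lemma order_ge_mderiv: "order_ge f d \<Longrightarrow> order_ge (mderiv j f) (d - 1)"
  by (simp add: order_ge_def mderiv_def mdegree_add mdegree_axis)


section \<open>Substitution\<close>

lemma order_ge_prod_power:
  assumes "map_order_ge G 1"
  shows "order_ge (\<Prod>i\<in>UNIV. (G $ i) ^ (\<beta> $ i)) (mdegree \<beta>)"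
proof -
  have "order_ge (\<Prod>i\<in>S. (G $ i) ^ (\<beta> $ i)) (\<Sum>i\<in>S. \<beta> $ i)" if "finite S" for S
    using that
  proof induction
    case (insert i S)
    have "order_ge (G $ i ^ (\<beta> $ i)) (\<beta> $ i)"
      using assms order_ge_power [of "G $ i" 1] by (simp add: map_order_ge_iff)
    with insert show ?case
      by (simp add: order_ge_mult)
  qed simp
  then show ?thesis
    by (simp add: mdegree_def)
qed

text \<open>
  The coefficients of a substitution in degrees up to \<open>N\<close> are those of one finite sum that does not
  depend on the degree.  This truncation is an element of the ring to which derivations apply.
\<close>

lemma mcoeff_msubst:
  assumes "map_order_ge G 1" and "mdegree \<alpha> \<le> N"
  shows "mcoeff (msubst f G) \<alpha> =
    mcoeff (\<Sum>\<beta> | mdegree \<beta> \<le> N. mconst (mcoeff f \<beta>) * (\<Prod>i\<in>UNIV. (G $ i) ^ (\<beta> $ i))) \<alpha>"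
  unfolding msubst_def mcoeff_Abs_mfps mcoeff_sum mcoeff_mconst_mult
proof (rule sum.mono_neutral_left [OF finite_mdegree_le])
  show "\<forall>\<beta>\<in>{\<beta>. mdegree \<beta> \<le> N} - {\<beta>. mdegree \<beta> \<le> mdegree \<alpha>}.
      mcoeff f \<beta> * mcoeff (\<Prod>i\<in>UNIV. (G $ i) ^ (\<beta> $ i)) \<alpha> = 0"
    using order_geD [OF order_ge_prod_power [OF assms(1)]] by auto
qed (use assms in auto)

lemma msubst_add: "msubst (f + g) G = msubst f G + msubst g G"
  and msubst_diff: "msubst (f - g) G = msubst f G - msubst g G"
  by (rule mfps_eqI;
      simp add: msubst_def algebra_simps sum.distrib sum_subtractf)+

lemma msubst_mvars: "msubst f mvars = f"
proof (rule mfps_eqI)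
  fix \<alpha>
  have "mcoeff (msubst f mvars) \<alpha> =
      (\<Sum>\<beta> | mdegree \<beta> \<le> mdegree \<alpha>. if \<beta> = \<alpha> then mcoeff f \<alpha> else 0)"
    by (auto simp: msubst_def mvars_def prod_mvar_power mmonom_def intro!: sum.cong)
  then show "mcoeff (msubst f mvars) \<alpha> = mcoeff f \<alpha>"
    by (simp add: finite_mdegree_le)
qed

lemma msubst_mvar:
  assumes "map_order_ge G 1"
  shows "msubst (mvar i) G = G $ i"
proof (rule mfps_eqI)
  fix \<alpha>
  have "(\<Prod>k\<in>UNIV. (G $ k) ^ (axis i 1 $ k)) = (\<Prod>k\<in>UNIV. if k = i then G $ i else 1)"
    by (rule prod.cong) (auto simp: axis_def)
  then have p: "(\<Prod>k\<in>UNIV. (G $ k) ^ (axis i 1 $ k)) = G $ i"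
    by simp
  have "mcoeff (msubst (mvar i) G) \<alpha> = (\<Sum>\<beta> | mdegree \<beta> \<le> Suc (mdegree \<alpha>).
      if \<beta> = axis i 1 then mcoeff (\<Prod>k\<in>UNIV. (G $ k) ^ (axis i 1 $ k)) \<alpha> else 0)"
    by (subst mcoeff_msubst [OF assms, of _ "Suc (mdegree \<alpha>)"])
      (auto simp: mcoeff_sum mvar_def intro!: sum.cong)
  then show "mcoeff (msubst (mvar i) G) \<alpha> = mcoeff (G $ i) \<alpha>"
    unfolding p by (simp add: finite_mdegree_le mdegree_axis)
qed


section \<open>The derivation along a formal vector field\<close>

definition lie_deriv ::
    "('a::comm_ring_1, 'n::finite) mfps ^ 'n \<Rightarrow> ('a, 'n) mfps \<Rightarrow> ('a, 'n) mfps" where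
  "lie_deriv H f = (\<Sum>j\<in>UNIV. H $ j * mderiv j f)"

lemma jacobian_mult_vec: "(jacobian_mfps F *v H) $ i = lie_deriv H (F $ i)"
  by (simp add: matrix_vector_mult_def jacobian_mfps_def lie_deriv_def mult.commute)

lemma lie_deriv_add: "lie_deriv H (f + g) = lie_deriv H f + lie_deriv H g"
  and lie_deriv_diff: "lie_deriv H (f - g) = lie_deriv H f - lie_deriv H g"
  by (simp_all add: lie_deriv_def mderiv_add mderiv_diff ring_distribs sum.distrib sum_subtractf)

lemma lie_deriv_mconst_mult: "lie_deriv H (mconst c * f) = mconst c * lie_deriv H f"
  by (simp add: lie_deriv_def mderiv_mconst_mult sum_distrib_left mult.left_commute)

lemma lie_deriv_mult: "lie_deriv H (f * g) = lie_deriv H f * g + f * lie_deriv H g"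
  by (simp add: lie_deriv_def mderiv_mult sum_distrib_left sum_distrib_right
      ring_distribs sum.distrib mult_ac)

lemma lie_deriv_mvar: "lie_deriv H (mvar i) = H $ i"
  by (simp add: lie_deriv_def mderiv_mvar if_distrib cong: if_cong)

text \<open>
  Differentiation lowers the order by at most one, and multiplication by \<open>H_j\<close> raises it by two.
\<close>

lemma order_ge_lie_deriv:
  assumes "map_order_ge H 2" and "order_ge f d"
  shows "order_ge (lie_deriv H f) (Suc d)"
  unfolding lie_deriv_def
proof (rule order_ge_sum)
  fix j
  have "order_ge (H $ j * mderiv j f) (2 + (d - 1))"
    using assms by (intro order_ge_mult order_ge_mderiv) (auto simp: map_order_ge_iff)
  then show "order_ge (H $ j * mderiv j f) (Suc d)"
    by (rule order_ge_mono) simp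
qed


section \<open>Curves of power series and their defect from the flow\<close>

text \<open>
  The relation says \<open>(d/dt) g - D g = r\<close> at the time \<open>t\<close>, where \<open>D\<close> is the derivation along \<open>H\<close> and
  \<open>d/dt\<close> is taken coefficient by coefficient.
\<close>

definition has_flow_defect ::
    "(complex, 'n::finite) mfps ^ 'n \<Rightarrow> (complex \<Rightarrow> (complex, 'n) mfps) \<Rightarrow>
      (complex, 'n) mfps \<Rightarrow> complex \<Rightarrow> bool" where
  "has_flow_defect H g r t \<longleftrightarrow> (\<forall>\<alpha>. ((\<lambda>s. mcoeff (g s) \<alpha>) has_field_derivative
     mcoeff (lie_deriv H (g t) + r) \<alpha>) (at t))"

lemma has_flow_defect_const: "has_flow_defect H (\<lambda>s. f) (- lie_deriv H f) t"
  by (simp add: has_flow_defect_def)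

lemma has_flow_defect_linear:
  "has_flow_defect H (\<lambda>s. mconst s * f) (f - mconst t * lie_deriv H f) t"
  by (auto simp: has_flow_defect_def lie_deriv_mconst_mult intro!: derivative_eq_intros)

lemma has_flow_defect_add:
  "has_flow_defect H g r t \<Longrightarrow> has_flow_defect H h q t \<Longrightarrow>
    has_flow_defect H (\<lambda>s. g s + h s) (r + q) t"
  unfolding has_flow_defect_def
  by (auto simp: lie_deriv_add intro!: derivative_eq_intros)

lemma has_flow_defect_diff:
  "has_flow_defect H g r t \<Longrightarrow> has_flow_defect H h q t \<Longrightarrow>
    has_flow_defect H (\<lambda>s. g s - h s) (r - q) t"
  unfolding has_flow_defect_def
  by (auto simp: lie_deriv_diff intro!: derivative_eq_intros)

lemma has_flow_defect_mconst_mult: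
  "has_flow_defect H g r t \<Longrightarrow> has_flow_defect H (\<lambda>s. mconst c * g s) (mconst c * r) t"
  unfolding has_flow_defect_def lie_deriv_mconst_mult
  by (simp only: mcoeff_mconst_mult DERIV_cmult simp_thms flip: distrib_left)

text \<open>Both \<open>d/dt\<close> and \<open>D\<close> satisfy the Leibniz rule, hence so does their difference.\<close>

lemma has_flow_defect_mult:
  assumes "has_flow_defect H g r t" and "has_flow_defect H h q t"
  shows "has_flow_defect H (\<lambda>s. g s * h s) (r * h t + g t * q) t"
  unfolding has_flow_defect_def
proof
  fix \<alpha>
  let ?g' = "lie_deriv H (g t) + r" and ?h' = "lie_deriv H (h t) + q"
  have "((\<lambda>s. \<Sum>(\<beta>, \<gamma>)\<in>antidiag \<alpha>. mcoeff (g s) \<beta> * mcoeff (h s) \<gamma>) has_field_derivative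
      (\<Sum>(\<beta>, \<gamma>)\<in>antidiag \<alpha>. mcoeff ?g' \<beta> * mcoeff (h t) \<gamma> + mcoeff ?h' \<gamma> * mcoeff (g t) \<beta>)) (at t)"
    unfolding case_prod_beta
    using assms by (intro DERIV_sum DERIV_mult) (simp_all add: has_flow_defect_def)
  also have "(\<lambda>s. \<Sum>(\<beta>, \<gamma>)\<in>antidiag \<alpha>. mcoeff (g s) \<beta> * mcoeff (h s) \<gamma>) = (\<lambda>s. mcoeff (g s * h s) \<alpha>)"
    by (simp add: mcoeff_mult)
  also have "(\<Sum>(\<beta>, \<gamma>)\<in>antidiag \<alpha>. mcoeff ?g' \<beta> * mcoeff (h t) \<gamma> + mcoeff ?h' \<gamma> * mcoeff (g t) \<beta>)
      = mcoeff (?g' * h t + g t * ?h') \<alpha>"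
    by (simp only: mcoeff_add [of "?g' * h t" "g t * ?h'"] mcoeff_mult)
      (simp add: sum.distrib case_prod_beta mult.commute)
  also have "?g' * h t + g t * ?h' = lie_deriv H (g t * h t) + (r * h t + g t * q)"
    by (simp add: lie_deriv_mult algebra_simps)
  finally show "((\<lambda>s. mcoeff (g s * h s) \<alpha>) has_field_derivative
      mcoeff (lie_deriv H (g t * h t) + (r * h t + g t * q)) \<alpha>) (at t)" .
qed

text \<open>
  This is uniqueness for the equation \<open>dw/dt = D w\<close> modulo terms of order \<open>m\<close>.  Since \<open>D\<close> raises
  the order, the coefficients of \<open>D w\<close> in degree \<open>n\<close> depend only on those of \<open>w\<close> in lower degrees;
  once these vanish, the coefficients of \<open>w\<close> in degree \<open>n\<close> are constant in \<open>t\<close>.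
\<close>

lemma order_ge_of_small_flow_defect:
  assumes H: "map_order_ge H 2"
    and w: "\<And>t. \<exists>r. has_flow_defect H w r t \<and> order_ge r m"
    and w0: "order_ge (w 0) m"
  shows "order_ge (w t) m"
proof -
  have "n \<le> m \<Longrightarrow> \<forall>t. order_ge (w t) n" for n
  proof (induction n)
    case (Suc n)
    have "mcoeff (w t) \<alpha> = 0" if "mdegree \<alpha> \<le> n" for t \<alpha>
    proof -
      have "((\<lambda>s. mcoeff (w s) \<alpha>) has_field_derivative 0) (at t)" for t
      proof -
        obtain r where r: "has_flow_defect H w r t" "order_ge r m"
          using w by blast
        have "order_ge (lie_deriv H (w t)) (Suc n)"
          using Suc by (intro order_ge_lie_deriv [OF H]) auto
        then have "mcoeff (lie_deriv H (w t) + r) \<alpha> = 0"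
          using order_geD r(2) that Suc.prems by (simp add: order_ge_def)
        then show ?thesis
          using r(1) unfolding has_flow_defect_def by metis
      qed
      then obtain c where "mcoeff (w s) \<alpha> = c" for s
        using has_field_derivative_zero_constant [of UNIV "\<lambda>s. mcoeff (w s) \<alpha>"] by auto
      moreover have "mcoeff (w 0) \<alpha> = 0"
        using w0 that Suc.prems by (simp add: order_ge_def)
      ultimately show ?thesis
        by metis
    qed
    then show ?case
      by (simp add: order_ge_def)
  qed simp
  then show ?thesis by blast
qed

text \<open>
  The excess \<open>e\<close> of the order of the defect over the order \<open>a\<close> of the curve is what products
  preserve: in the defect \<open>r h + g q\<close> of \<open>g h\<close>, the factors \<open>h\<close> and \<open>g\<close> contribute their own orders.
\<close>

definition near_flow ::
    "(complex, 'n::finite) mfps ^ 'n \<Rightarrow> nat \<Rightarrow> complex \<Rightarrow> nat \<Rightarrow>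
      (complex \<Rightarrow> (complex, 'n) mfps) \<Rightarrow> bool" where
  "near_flow H e t a g \<longleftrightarrow> order_ge (g t) a \<and> (\<exists>r. has_flow_defect H g r t \<and> order_ge r (e + a))"

lemma near_flow_mult:
  assumes "near_flow H e t a g" and "near_flow H e t b h"
  shows "near_flow H e t (a + b) (\<lambda>s. g s * h s)"
proof -
  obtain r q where rq: "has_flow_defect H g r t" "order_ge r (e + a)"
      "has_flow_defect H h q t" "order_ge q (e + b)"
    and gh: "order_ge (g t) a" "order_ge (h t) b"
    using assms unfolding near_flow_def by blast
  have "order_ge (r * h t + g t * q) (e + (a + b))"
    using order_ge_mult [OF rq(2) gh(2)] order_ge_mult [OF gh(1) rq(4)]
    by (intro order_ge_add) (simp_all add: add_ac)
  then show ?thesis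
    unfolding near_flow_def
    using order_ge_mult [OF gh] has_flow_defect_mult [OF rq(1,3)] by blast
qed

lemma near_flow_one: "near_flow H e t 0 (\<lambda>s. 1)"
proof -
  have "lie_deriv H 1 = 0"
    using lie_deriv_mult [of H 1 1] by simp
  then show ?thesis
    using has_flow_defect_const [of H 1 t] by (auto simp: near_flow_def intro!: exI [of _ 0])
qed

lemma near_flow_power: "near_flow H e t a g \<Longrightarrow> near_flow H e t (k * a) (\<lambda>s. g s ^ k)"
  by (induction k) (auto simp: near_flow_one intro: near_flow_mult)

lemma near_flow_prod_power:
  assumes "\<And>i. near_flow H e t 1 (\<lambda>s. G s $ i)"
  shows "near_flow H e t (mdegree \<beta>) (\<lambda>s. \<Prod>i\<in>UNIV. (G s $ i) ^ (\<beta> $ i))"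
proof -
  have "near_flow H e t (\<Sum>i\<in>S. \<beta> $ i) (\<lambda>s. \<Prod>i\<in>S. (G s $ i) ^ (\<beta> $ i))" if "finite S" for S
    using that
  proof induction
    case (insert i S)
    have "near_flow H e t (\<beta> $ i) (\<lambda>s. (G s $ i) ^ (\<beta> $ i))"
      using near_flow_power [OF assms, of "\<beta> $ i" i] by simp
    with insert show ?case
      by (simp add: near_flow_mult)
  qed (simp add: near_flow_one)
  then show ?thesis
    by (simp add: mdegree_def)
qed

lemma near_flow_zero: "near_flow H e t a (\<lambda>s. 0)"
  by (auto simp: near_flow_def has_flow_defect_def lie_deriv_def mderiv_def mcoeff_sum mcoeff_mult
      intro!: exI [of _ 0])

lemma near_flow_add:
  "near_flow H e t a g \<Longrightarrow> near_flow H e t a h \<Longrightarrow> near_flow H e t a (\<lambda>s. g s + h s)"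
  unfolding near_flow_def by (blast intro: order_ge_add has_flow_defect_add)

lemma near_flow_mconst_mult: "near_flow H e t a g \<Longrightarrow> near_flow H e t a (\<lambda>s. mconst c * g s)"
  unfolding near_flow_def by (blast intro: order_ge_mconst_mult has_flow_defect_mconst_mult)

lemma near_flow_mono: "near_flow H e t a g \<Longrightarrow> b \<le> a \<Longrightarrow> near_flow H e t b g"
  unfolding near_flow_def by (meson add_left_mono order_ge_mono)

lemma near_flow_sum:
  "(\<And>x. x \<in> S \<Longrightarrow> near_flow H e t a (g x)) \<Longrightarrow> near_flow H e t a (\<lambda>s. \<Sum>x\<in>S. g x s)"
  by (induction S rule: infinite_finite_induct) (simp_all add: near_flow_zero near_flow_add)


section \<open>Translation along \<open>H\<close>\<close>

definition translate :: "(complex, 'n::finite) mfps ^ 'n \<Rightarrow> complex \<Rightarrow> (complex, 'n) mfps ^ 'n" where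
  "translate H t = (\<chi> i. mvar i + mconst t * H $ i)"

lemma translate_special: "translate H 0 = mvars" "translate H 1 = mvars + H" "translate H (-1) = mvars - H"
  by (simp_all add: translate_def mvars_def vec_eq_iff)

lemma map_order_ge_translate:
  assumes "map_order_ge H 2"
  shows "map_order_ge (translate H t) 1"
  unfolding map_order_ge_iff
proof
  fix i
  have "order_ge (H $ i) 1"
    using assms order_ge_mono [of "H $ i" 2 1] by (simp add: map_order_ge_iff)
  then show "order_ge (translate H t $ i) 1"
    unfolding translate_def vec_lambda_beta by (intro order_ge_add order_ge_mvar order_ge_mconst_mult)
qed

text \<open>
  The line \<open>z + t H\<close> has velocity \<open>H\<close>, whereas \<open>D (z + t H) = H + t D H\<close>, so its defect is \<open>- t D H\<close>.
\<close>

lemma near_flow_translate: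
  assumes "map_order_ge H 2" and "\<And>i. order_ge (lie_deriv H (H $ i)) (Suc e)"
  shows "near_flow H e t 1 (\<lambda>s. translate H s $ i)"
proof -
  let ?r = "- lie_deriv H (mvar i) + (H $ i - mconst t * lie_deriv H (H $ i))"
  have "has_flow_defect H (\<lambda>s. translate H s $ i) ?r t"
    unfolding translate_def vec_lambda_beta
    by (intro has_flow_defect_add has_flow_defect_const has_flow_defect_linear)
  moreover have "order_ge ?r (e + 1)"
    using assms(2) by (simp add: lie_deriv_mvar order_ge_uminus order_ge_mconst_mult)
  ultimately show ?thesis
    using map_order_ge_translate [OF assms(1)] by (auto simp: near_flow_def map_order_ge_iff)
qed

text \<open>
  Formally \<open>f(z + t H)\<close> is \<open>exp (t D) f\<close> as long as \<open>D H\<close> can be neglected.  The terms of this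
  exponential beyond the linear one have order at least \<open>e + 2\<close> because \<open>D f\<close> has order at least
  \<open>e + 1\<close>.  That \<open>f\<close> has order at least \<open>2\<close> gives the substituted monomials a defect of order
  \<open>e + 2\<close>; a linear term of \<open>f\<close> would only give \<open>e + 1\<close>.
\<close>

lemma mcoeff_msubst_translate:
  assumes H: "map_order_ge H 2" and A: "\<And>i. order_ge (lie_deriv H (H $ i)) (Suc e)"
    and f: "order_ge f 2" and Df: "order_ge (lie_deriv H f) (Suc e)"
    and \<alpha>: "mdegree \<alpha> \<le> Suc e"
  shows "mcoeff (msubst f (translate H t)) \<alpha> = mcoeff f \<alpha> + t * mcoeff (lie_deriv H f) \<alpha>"
proof -
  define v where "v s = (\<Sum>\<beta> | mdegree \<beta> \<le> Suc e.
    mconst (mcoeff f \<beta>) * (\<Prod>i\<in>UNIV. (translate H s $ i) ^ (\<beta> $ i)))" for s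
  \<comment> \<open>The error of the claimed formula, with the substitution truncated to a finite sum.\<close>
  define w where "w s = v s - f - mconst s * lie_deriv H f" for s
  have v: "mcoeff (v s) \<gamma> = mcoeff (msubst f (translate H s)) \<gamma>" if "mdegree \<gamma> \<le> Suc e" for s \<gamma>
    using mcoeff_msubst [OF map_order_ge_translate [OF H] that] by (simp add: v_def)
  have "order_ge (w s) (e + 2)" for s
  proof (rule order_ge_of_small_flow_defect [OF H])
    show "order_ge (w 0) (e + 2)"
      by (simp add: order_ge_def w_def v translate_special msubst_mvars)
    fix s
    have "near_flow H e s 2 v"
      unfolding v_def
    proof (rule near_flow_sum)
      fix \<beta> :: "nat ^ 'a"
      show "near_flow H e s 2
          (\<lambda>s. mconst (mcoeff f \<beta>) * (\<Prod>i\<in>UNIV. (translate H s $ i) ^ (\<beta> $ i)))"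
      proof (cases "mdegree \<beta> < 2")
        case True
        then show ?thesis
          using f by (simp add: order_ge_def near_flow_zero)
      next
        case False
        then show ?thesis
          using near_flow_prod_power [OF near_flow_translate [OF H A]]
          by (intro near_flow_mconst_mult, intro near_flow_mono [where a = "mdegree \<beta>" and b = 2])
            auto
      qed
    qed
    then obtain r where r: "has_flow_defect H v r s" "order_ge r (e + 2)"
      unfolding near_flow_def by blast
    \<comment> \<open>The curve \<open>f + s D f\<close> has defect \<open>- s D (D f)\<close>.\<close>
    let ?D = "lie_deriv H f"
    have "has_flow_defect H w (r - (- ?D) - (?D - mconst s * lie_deriv H ?D)) s"
      unfolding w_def
      by (intro has_flow_defect_diff r has_flow_defect_const has_flow_defect_linear)
    moreover have "order_ge (r + mconst s * lie_deriv H ?D) (e + 2)"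
      using r(2) order_ge_lie_deriv [OF H Df]
      by (intro order_ge_add order_ge_mconst_mult) simp_all
    ultimately show "\<exists>r. has_flow_defect H w r s \<and> order_ge r (e + 2)"
      by (intro exI [of _ "r + mconst s * lie_deriv H ?D"]) simp
  qed
  then have "mcoeff (w t) \<alpha> = 0"
    using \<alpha> by (simp add: order_ge_def)
  then show ?thesis
    using v [OF \<alpha>, of t] by (simp add: w_def algebra_simps)
qed


section \<open>The inverse of \<open>z - H\<close>\<close>

lemma is_formal_inverse_iff_msubst:
  assumes "map_order_ge H 2"
  shows "is_formal_inverse (mvars - H) (mvars + H) \<longleftrightarrow>
    (\<forall>i. msubst (H $ i) (translate H 1) = H $ i) \<and> (\<forall>i. msubst (H $ i) (translate H (-1)) = H $ i)"
proof -
  have o: "map_order_ge (mvars + H) 1" "map_order_ge (mvars - H) 1"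
    using map_order_ge_translate [OF assms] by (metis translate_special)+
  have "map_compose (mvars - H) (mvars + H) = mvars \<longleftrightarrow> (\<forall>i. msubst (H $ i) (translate H 1) = H $ i)"
    using msubst_mvar [OF o(1)]
    by (auto simp: map_compose_def vec_eq_iff msubst_diff mvars_def translate_special)
  moreover have "map_compose (mvars + H) (mvars - H) = mvars \<longleftrightarrow>
      (\<forall>i. msubst (H $ i) (translate H (-1)) = H $ i)"
    using msubst_mvar [OF o(2)]
    by (auto simp: map_compose_def vec_eq_iff msubst_add mvars_def translate_special)
  ultimately show ?thesis
    using o by (simp add: is_formal_inverse_def)
qed

theorem proposition3p8:
  fixes H :: "(complex, 'n::finite) mfps ^ 'n"
  assumes "map_order_ge H 2"
  shows "is_formal_inverse (mvars - H) (mvars + H) \<longleftrightarrow> jacobian_mfps H *v H = 0"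
proof -
  have o: "order_ge (H $ i) 2" for i
    using assms by (simp add: map_order_ge_iff)
  have linear: "mcoeff (msubst (H $ i) (translate H t)) \<alpha> =
      mcoeff (H $ i) \<alpha> + t * mcoeff (lie_deriv H (H $ i)) \<alpha>"
    if "\<And>i. order_ge (lie_deriv H (H $ i)) (Suc e)" "mdegree \<alpha> \<le> Suc e" for e i t \<alpha>
    using mcoeff_msubst_translate [OF assms that(1) o that] .
  have "(\<forall>i. msubst (H $ i) (translate H 1) = H $ i) \<and> (\<forall>i. msubst (H $ i) (translate H (-1)) = H $ i)
    \<longleftrightarrow> (\<forall>i. lie_deriv H (H $ i) = 0)"
  proof
    assume fixed: "(\<forall>i. msubst (H $ i) (translate H 1) = H $ i) \<and>
      (\<forall>i. msubst (H $ i) (translate H (-1)) = H $ i)"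
    have "\<forall>i. order_ge (lie_deriv H (H $ i)) (Suc e)" for e
    proof (induction e)
      \<comment> \<open>No series \<open>D f\<close> has a constant term, because \<open>H\<close> has none.\<close>
      case 0
      show ?case
        using order_ge_lie_deriv [OF assms order_ge_0] by simp
    next
      case (Suc e)
      have "mcoeff (lie_deriv H (H $ i)) \<alpha> = 0" if "mdegree \<alpha> \<le> Suc e" for i \<alpha>
        using linear [of e \<alpha> i 1] Suc that fixed by simp
      then show ?case
        by (simp add: order_ge_def)
    qed
    then show "\<forall>i. lie_deriv H (H $ i) = 0"
      by (metis (no_types) lessI mcoeff_zero mfps_eqI order_geD)
  next
    assume zero: "\<forall>i. lie_deriv H (H $ i) = 0"
    have "msubst (H $ i) (translate H t) = H $ i" for i t
    proof (rule mfps_eqI)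
      fix \<alpha>
      show "mcoeff (msubst (H $ i) (translate H t)) \<alpha> = mcoeff (H $ i) \<alpha>"
        using linear [of "mdegree \<alpha>" \<alpha> i t] zero by simp
    qed
    then show "(\<forall>i. msubst (H $ i) (translate H 1) = H $ i) \<and>
      (\<forall>i. msubst (H $ i) (translate H (-1)) = H $ i)"
      by blast
  qed
  then show ?thesis
    by (simp add: is_formal_inverse_iff_msubst [OF assms] vec_eq_iff jacobian_mult_vec)
qed

end
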